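(* Consider the algorithm Aim-High (AH) in the static setting, with $\eta=\max\{n,\mathcal{C}\}$. With high probability in $\eta$, AH solves the static wakeup problem, and the following hold w.h.p. in $\eta$: (1) If $\mathcal{C}=\Omega(\log^{\Theta(1/\epsilon)} n)$, then the latency and the expected collision cost are each $O(\mathcal{C}^{\frac12+2\epsilon})$. (2) Otherwise, the latency and the expected collision cost are each $O(\log^{\Theta(1/\epsilon)} n)$.
   Context: Model: there are $n$ packets ($n$ large and unknown to the packets). Time is divided into slots and packets share a multiple access channel: in each slot each active packet either sends or listens; if no packet sends the slot is empty, if exactly one sends it is a success, and if two or more send it is a collision and none of them succeeds. There is no collision detection (an empty slot cannot be distinguished from a collision), packets have no identifiers, and there is no central coordinator. The wakeup problem is solved at the first success. Latency is the number of slots from the first packet activation until the first success. Each collision costs a value $\mathcal{C}\ge 4$ known to the packets, chosen by an adversary who knows $n$, subject to $\mathcal{C}=O(\mathrm{poly}(n))$; the collision cost is $\mathcal{C}$ times the number of collisions. Static setting: all $n$ packets are active from slot 1 and agree on the slot index. An event holds w.h.p. in $x$ if it has probability at least $1-O(1/\mathrm{poly}(x))$ where the constant degree of the polynomial can be made arbitrarily large (here by choosing the algorithm's constant $d$ large); "w.h.p. in $x$ the expected value $E[X]\le v$" means that the total probability of the outcomes with $X>v$ is $O(1/\mathrm{poly}(x))$ in the same sense. $\epsilon$ is a small positive constant ($\epsilon\ll 1$) fixed by the algorithm before execution; $\log^{\Theta(1/\epsilon)} n$ denotes $\log^{k+k'/\epsilon} n$ for some constants $k,k'\ge 1$. Algorithm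 AH (run by each packet, with a constant $d>0$): initialize $w_{cur}=w_0=2^{\mathcal{C}^{\epsilon}}$. Halving phase: while $w_{cur}\ge 2$, execute a large sample of $d\sqrt{\mathcal{C}}\,\ell$ slots, in each of which the packet independently sends with probability $1/w_{cur}$; on a success the algorithm terminates; if the sample has no success, set $w_{cur}\leftarrow w_{cur}/2$. Doubling phase (if the halving phase ends without success): repeatedly double $w_{cur}$ (starting from window size $4$) and execute a small sample of $d\ell$ slots, in each of which the packet sends with probability $1/w_{cur}$, terminating on a success. In the static setting $\ell=\ln(w_{cur})$.
   Formalization: In (1), "w.h.p. the expected collision cost" is read as the conditional expectation of the cost given the latency, not the realised cost, for which the bound fails (C = n, small ε: one collision already costs C and has probability about 1/√C up to log factors). *)

theory Defs
  imports "HOL-Probability.Probability"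
begin

section \<open>The algorithm Aim-High in the static setting\<close>

text \<open>
  In the static setting all packets are active from the first slot and agree on the slot index, so
  as long as there has been no success they are all in the same state: the phase, the current
  window (a real number, as the initial window is \<open>2 powr (C powr \<epsilon>)\<close>), and the number of slots of
  the current sample that have not been completed yet. Sample sizes are rounded up; they are
  positive, because \<open>d > 0\<close> and all windows are at least 2.
\<close>

datatype phase = Halving | Doubling

type_synonym ah_state = "phase \<times> real \<times> nat"

definition large_sample :: "real \<Rightarrow> real \<Rightarrow> real \<Rightarrow> nat" where
  "large_sample d C w = nat \<lceil>d * sqrt C * ln w\<rceil>"

definition small_sample :: "real \<Rightarrow> real \<Rightarrow> nat" where
  "small_sample d w = nat \<lceil>d * ln w\<rceil>"

definition halving_test :: "real \<Rightarrow> real \<Rightarrow> real \<Rightarrow> ah_state" where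
  "halving_test d C w =
     (if 2 \<le> w then (Halving, w, large_sample d C w) else (Doubling, 4, small_sample d 4))"

fun next_slot :: "real \<Rightarrow> real \<Rightarrow> ah_state \<Rightarrow> ah_state" where
  "next_slot d C (ph, w, r) =
     (if 1 < r then (ph, w, r - 1)
      else case ph of
        Halving \<Rightarrow> halving_test d C (w / 2)
      | Doubling \<Rightarrow> (Doubling, 2 * w, small_sample d (2 * w)))"

text \<open>The window used in the slot with index \<open>t\<close> (counted from 0), if that slot is reached.\<close>

definition window :: "real \<Rightarrow> real \<Rightarrow> real \<Rightarrow> nat \<Rightarrow> real" where
  "window d C \<epsilon> t = fst (snd ((next_slot d C ^^ t) (halving_test d C (2 powr (C powr \<epsilon>)))))"


section \<open>The random execution\<close>

text \<open>
  An outcome \<open>\<omega>\<close> tells for each slot \<open>t\<close> and each packet \<open>i < n\<close> whether the packet sends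
  (\<open>\<omega> t i\<close>); all these decisions are independent. The decisions after the first success are drawn
  as well, but nothing below depends on them: the algorithm has terminated by then.
\<close>

definition AH :: "real \<Rightarrow> real \<Rightarrow> real \<Rightarrow> nat \<Rightarrow> (nat \<Rightarrow> nat \<Rightarrow> bool) measure" where
  "AH d C \<epsilon> n =
     PiM UNIV (\<lambda>t. measure_pmf (Pi_pmf {..<n} False (\<lambda>_. bernoulli_pmf (1 / window d C \<epsilon> t))))"

definition senders :: "nat \<Rightarrow> (nat \<Rightarrow> bool) \<Rightarrow> nat" where
  "senders n b = card {i. i < n \<and> b i}"

definition success :: "nat \<Rightarrow> (nat \<Rightarrow> bool) \<Rightarrow> bool" where
  "success n b \<longleftrightarrow> senders n b = 1"

definition collision :: "nat \<Rightarrow> (nat \<Rightarrow> bool) \<Rightarrow> bool" where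
  "collision n b \<longleftrightarrow> senders n b \<ge> 2"

definition solved :: "nat \<Rightarrow> (nat \<Rightarrow> nat \<Rightarrow> bool) \<Rightarrow> bool" where
  "solved n \<omega> \<longleftrightarrow> (\<exists>t. success n (\<omega> t))"

text \<open>The number of slots up to and including the first success; \<open>\<infinity>\<close> if there is none.\<close>

definition latency :: "nat \<Rightarrow> (nat \<Rightarrow> nat \<Rightarrow> bool) \<Rightarrow> enat" where
  "latency n \<omega> = (INF t \<in> {t. success n (\<omega> t)}. enat (Suc t))"

definition collision_cost :: "real \<Rightarrow> nat \<Rightarrow> (nat \<Rightarrow> nat \<Rightarrow> bool) \<Rightarrow> ennreal" where
  "collision_cost C n \<omega> =
     (\<Sum>t. if enat t < latency n \<omega> \<and> collision n (\<omega> t) then ennreal C else 0)"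

text \<open>
  The expected collision cost of the executions that take as many slots as \<open>\<omega>\<close> does, that is,
  \<open>E[cost | latency]\<close> as a random variable. ``With high probability the expected collision cost is
  at most \<open>v\<close>'' is read as: the outcomes for which this value exceeds \<open>v\<close> have small total
  probability. It cannot be the collision cost itself that is compared with a bound
  \<open>v = O(C powr (1/2 + 2 * \<epsilon>))\<close>: a single collision already costs \<open>C\<close>, and at least one occurs with
  probability about \<open>1 / (d * sqrt C * ln w)\<close>, where \<open>w\<close> is about \<open>d * n * sqrt C * ln w\<close>.
\<close>

definition expected_collision_cost ::
    "real \<Rightarrow> real \<Rightarrow> real \<Rightarrow> nat \<Rightarrow> (nat \<Rightarrow> nat \<Rightarrow> bool) \<Rightarrow> ennreal" where
  "expected_collision_cost d C \<epsilon> n \<omega> =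
     (\<integral>\<^sup>+ x. collision_cost C n x
        \<partial>uniform_measure (AH d C \<epsilon> n) {x \<in> space (AH d C \<epsilon> n). latency n x = latency n \<omega>})"

end

theory Submission
  imports Defs "HOL-Real_Asymp.Real_Asymp"
begin

text \<open>
  In a slot with window \<open>w \<ge> 2 * n\<close> a success has probability at least \<open>n / (2 * w)\<close>, and, given no
  success, a collision has probability at most \<open>2 * (n / w)\<^sup>2\<close>. If \<open>C\<close> is larger than a suitable
  power of \<open>ln n\<close>, the initial window exceeds \<open>n * sqrt C\<close>, and the halving phase succeeds with high
  probability by the end of the sample whose window is about \<open>n * sqrt C\<close>; there are at most
  \<open>C powr \<epsilon>\<close> samples before it, each of length \<open>O(C powr (1 / 2 + \<epsilon>))\<close>, and the expected number of
  collisions up to it is \<open>O(C powr (\<epsilon> - 1 / 2))\<close> because the windows decrease geometrically.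
  Otherwise \<open>C\<close> and hence the whole halving phase are polylogarithmic in \<open>n\<close>, and should it fail,
  the doubling phase reaches a window between \<open>2 * n\<close> and \<open>4 * n\<close> after \<open>O((ln n)\<^sup>2)\<close> slots; then even
  \<open>C\<close> times the number of slots is polylogarithmic.
\<close>

subsection \<open>Latency as a random variable\<close>

lemma latency_eq:
  assumes "success n (\<omega> t)" "\<And>s. s < t \<Longrightarrow> \<not> success n (\<omega> s)"
  shows "latency n \<omega> = enat (Suc t)"
  unfolding latency_def
proof (rule antisym)
  show "(INF t\<in>{t. success n (\<omega> t)}. enat (Suc t)) \<le> enat (Suc t)"
    using assms(1) by (intro INF_lower) auto
  show "enat (Suc t) \<le> (INF t\<in>{t. success n (\<omega> t)}. enat (Suc t))"
    using assms(2) by (intro INF_greatest) (auto simp: not_less[symmetric])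
qed

lemma latency_cases:
  obtains "\<And>t. \<not> success n (\<omega> t)" "latency n \<omega> = \<infinity>"
  | t where "success n (\<omega> t)" "\<And>s. s < t \<Longrightarrow> \<not> success n (\<omega> s)" "latency n \<omega> = enat (Suc t)"
proof (cases "\<exists>t. success n (\<omega> t)")
  case True
  then obtain t where "success n (\<omega> t)" "\<And>s. s < t \<Longrightarrow> \<not> success n (\<omega> s)"
    using exists_least_iff[of "\<lambda>t. success n (\<omega> t)"] by blast
  with that(2) latency_eq show ?thesis by blast
next
  case False
  then have "latency n \<omega> = \<infinity>"
    by (simp add: latency_def top_enat_def)
  with False that(1) show ?thesis by blast
qed

lemma latency_eq_enat_Suc_iff:
  "latency n \<omega> = enat (Suc t) \<longleftrightarrow> success n (\<omega> t) \<and> (\<forall>s<t. \<not> success n (\<omega> s))"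
proof (cases n \<omega> rule: latency_cases)
  case (2 u)
  then show ?thesis by (metis latency_eq enat.inject nat.inject)
qed auto

lemma latency_le_iff: "latency n \<omega> \<le> enat T \<longleftrightarrow> (\<exists>t<T. success n (\<omega> t))"
proof (cases n \<omega> rule: latency_cases)
  case (2 u)
  then show ?thesis by (auto simp: Suc_le_eq) (meson not_less order_trans less_le_trans leI)
qed auto

lemma collision_imp_not_success: "collision n b \<Longrightarrow> \<not> success n b"
  by (simp add: collision_def success_def)

text \<open>The slot of the first success is not a collision, so the sum stops before slot
  \<open>t\<close> although the latency is \<open>Suc t\<close>.\<close>

lemma collision_cost_eq:
  assumes "latency n \<omega> = enat (Suc t)"
  shows "collision_cost C n \<omega> = (\<Sum>s<t. if collision n (\<omega> s) then ennreal C else 0)"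
proof -
  have "\<not> collision n (\<omega> t)"
    using assms by (auto simp: latency_eq_enat_Suc_iff dest: collision_imp_not_success)
  then have "collision_cost C n \<omega> =
      (\<Sum>s<t. if enat s < latency n \<omega> \<and> collision n (\<omega> s) then ennreal C else 0)"
    unfolding collision_cost_def
    by (intro suminf_finite) (auto simp: assms less_Suc_eq)
  also have "\<dots> = (\<Sum>s<t. if collision n (\<omega> s) then ennreal C else 0)"
    by (intro sum.cong) (auto simp: assms)
  finally show ?thesis .
qed

lemma collision_cost_le:
  assumes "C \<ge> 0" "latency n \<omega> \<le> enat T"
  shows "collision_cost C n \<omega> \<le> ennreal (C * real T)"
proof (cases n \<omega> rule: latency_cases)
  case 1
  with assms show ?thesis by simp
next
  case (2 t)
  have "collision_cost C n \<omega> \<le> (\<Sum>s<t. ennreal C)"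
    unfolding collision_cost_eq[OF 2(3)] by (intro sum_mono) auto
  also have "\<dots> = ennreal (C * real t)"
    using assms(1) by (simp add: ennreal_mult ennreal_of_nat_eq_real_of_nat mult.commute)
  also have "\<dots> \<le> ennreal (C * real T)"
    using assms 2(3) by (intro ennreal_leI mult_left_mono) auto
  finally show ?thesis .
qed


subsection \<open>Independent slots with prescribed windows\<close>

definition slot_pmf :: "nat \<Rightarrow> real \<Rightarrow> (nat \<Rightarrow> bool) pmf" where
  "slot_pmf n w = Pi_pmf {..<n} False (\<lambda>_. bernoulli_pmf (1 / w))"

text \<open>The windows form an arbitrary sequence, so that the probabilistic facts stay separate
  from the way the algorithm computes its windows.\<close>

definition slots :: "nat \<Rightarrow> (nat \<Rightarrow> real) \<Rightarrow> (nat \<Rightarrow> nat \<Rightarrow> bool) measure" where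
  "slots n w = PiM UNIV (\<lambda>t. measure_pmf (slot_pmf n (w t)))"

lemma AH_eq_slots: "AH d C \<epsilon> n = slots n (window d C \<epsilon>)"
  by (simp add: AH_def slots_def slot_pmf_def)

lemma space_slots [simp]: "space (slots n w) = UNIV"
  by (simp add: slots_def space_PiM)

lemma prob_space_slots: "prob_space (slots n w)"
  unfolding slots_def by (intro prob_space_PiM) (rule measure_pmf.prob_space_axioms)

lemma measurable_slot [measurable]: "(\<lambda>\<omega>. \<omega> t) \<in> measurable (slots n w) (count_space UNIV)"
proof -
  have "(\<lambda>\<omega>. \<omega> t) \<in> measurable (slots n w) (measure_pmf (slot_pmf n (w t)))"
    unfolding slots_def by measurable
  then show ?thesis
    by (simp cong: measurable_cong_sets)
qed

lemma measurable_pred_slot [measurable]: "Measurable.pred (slots n w) (\<lambda>\<omega>. P (\<omega> t))"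
  by (rule measurable_compose[OF measurable_slot]) simp

text \<open>Independence of the slots. The predicate may vary with the slot, which covers events
  such as failures before slot \<open>t\<close> and a success in slot \<open>t\<close>.\<close>

lemma emeasure_slots_Collect:
  "emeasure (slots n w) {\<omega>. \<forall>s<T. P s (\<omega> s)} =
    (\<Prod>s<T. emeasure (slot_pmf n (w s)) {b. P s b})"
proof -
  interpret product_prob_space "\<lambda>t. measure_pmf (slot_pmf n (w t))" UNIV
    by unfold_locales
  show ?thesis
    using emeasure_PiM_Collect[of "{..<T}" "\<lambda>s. {b. P s b}"]
    by (simp add: space_PiM slots_def lessThan_def)
qed

lemma measure_slots_Collect:
  "measure (slots n w) {\<omega>. \<forall>s<T. P s (\<omega> s)} = (\<Prod>s<T. measure (slot_pmf n (w s)) {b. P s b})"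
  unfolding measure_def emeasure_slots_Collect
  by (simp add: measure_pmf.emeasure_eq_measure prod_ennreal prod_nonneg)

text \<open>As \<open>enat\<close> is countable, it suffices that every fibre is measurable, and
  each fibre is given by countably many conditions on single slots.\<close>

lemma measurable_latency [measurable]: "latency n \<in> measurable (slots m w) (count_space UNIV)"
proof -
  have *: "{\<omega>. latency n \<omega> = l} \<in> sets (slots m w)" for l
  proof -
    consider "l = 0" | t where "l = enat (Suc t)" | "l = \<infinity>"
      by (metis enat.exhaust old.nat.exhaust zero_enat_def)
    then show ?thesis
    proof cases
      case 1
      have "{\<omega>. latency n \<omega> = l} = {}"
        using 1 by (auto elim: latency_cases[of n])
          (metis enat_0_iff(1) i0_ne_infinity latency_cases nat.distinct(1))
      then show ?thesis by simp
    next
      case (2 t)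
      have "{\<omega>\<in>space (slots m w). success n (\<omega> t) \<and> (\<forall>s<t. \<not> success n (\<omega> s))} \<in> sets (slots m w)"
        by measurable
      then show ?thesis by (simp add: 2 latency_eq_enat_Suc_iff)
    next
      case 3
      have "latency n \<omega> = \<infinity> \<longleftrightarrow> (\<forall>t. \<not> success n (\<omega> t))" for \<omega>
        by (cases n \<omega> rule: latency_cases) auto
      moreover have "{\<omega>\<in>space (slots m w). \<forall>t. \<not> success n (\<omega> t)} \<in> sets (slots m w)"
        by measurable
      ultimately show ?thesis by (simp add: 3)
    qed
  qed
  have "countable (UNIV :: enat set)" by simp
  then show ?thesis
    by (subst measurable_count_space_eq_countable) (auto simp: vimage_def *)
qed

lemma measurable_collision_cost [measurable]:
  "collision_cost C n \<in> borel_measurable (slots m w)"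
  unfolding collision_cost_def[abs_def] by measurable

lemma prob_latency_le:
  "measure (slots n w) {\<omega>. latency n \<omega> \<le> enat T} =
    1 - (\<Prod>s<T. 1 - measure (slot_pmf n (w s)) {b. success n b})"
proof -
  interpret prob_space "slots n w" by (rule prob_space_slots)
  have [simp]: "{\<omega>. \<forall>s<T. \<not> success n (\<omega> s)} \<in> events"
  proof -
    have "{\<omega>\<in>space (slots n w). \<forall>s<T. \<not> success n (\<omega> s)} \<in> events" by measurable
    then show ?thesis by simp
  qed
  have "{\<omega>. latency n \<omega> \<le> enat T} = space (slots n w) - {\<omega>. \<forall>s<T. \<not> success n (\<omega> s)}"
    by (auto simp: latency_le_iff)
  then have "prob {\<omega>. latency n \<omega> \<le> enat T} = 1 - prob {\<omega>. \<forall>s<T. \<not> success n (\<omega> s)}"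
    by (simp add: prob_compl[symmetric])
  also have "prob {\<omega>. \<forall>s<T. \<not> success n (\<omega> s)} =
      (\<Prod>s<T. measure (slot_pmf n (w s)) {b. \<not> success n b})"
    by (rule measure_slots_Collect)
  also have "\<dots> = (\<Prod>s<T. 1 - measure (slot_pmf n (w s)) {b. success n b})"
    by (intro prod.cong refl)
       (simp add: measure_pmf.prob_compl[symmetric] Compl_eq_Diff_UNIV[symmetric] Collect_neg_eq)
  finally show ?thesis .
qed

text \<open>
  Given the latency, the slots before the last one are independent and conditioned on not being
  a success, so requiring a collision in slot \<open>s\<close> only changes the factor of that slot.
\<close>

lemma emeasure_latency_collision_le:
  assumes "s < t" "0 \<le> q"
    and "measure (slot_pmf n (w s)) {b. collision n b} \<le>
      q * measure (slot_pmf n (w s)) {b. \<not> success n b}"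
  shows "emeasure (slots n w) {\<omega>. latency n \<omega> = enat (Suc t) \<and> collision n (\<omega> s)} \<le>
    ennreal q * emeasure (slots n w) {\<omega>. latency n \<omega> = enat (Suc t)}"
proof -
  let ?P = "\<lambda>r b. if r = t then success n b else \<not> success n b"
  let ?Q = "\<lambda>r b. if r = s then collision n b else ?P r b"
  have 1: "{\<omega>. latency n \<omega> = enat (Suc t)} = {\<omega>. \<forall>r<Suc t. ?P r (\<omega> r)}"
    by (auto simp: latency_eq_enat_Suc_iff less_Suc_eq)
  \<comment> \<open>The requirement of no success in slot \<open>s\<close> can be replaced by that
    of a collision, because a collision implies it.\<close>
  have 2: "{\<omega>. latency n \<omega> = enat (Suc t) \<and> collision n (\<omega> s)} = {\<omega>. \<forall>r<Suc t. ?Q r (\<omega> r)}"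
    using assms(1)
    by (auto simp: latency_eq_enat_Suc_iff less_Suc_eq dest: collision_imp_not_success)
  have s: "s \<in> {..<Suc t}" using assms(1) by simp
  have "(\<Prod>r<Suc t. emeasure (slot_pmf n (w r)) {b. ?Q r b}) =
      emeasure (slot_pmf n (w s)) {b. collision n b} *
      (\<Prod>r\<in>{..<Suc t}-{s}. emeasure (slot_pmf n (w r)) {b. ?P r b})"
    by (subst prod.remove[OF _ s]) (auto intro!: arg_cong2[where f="(*)"] prod.cong)
  also have "\<dots> \<le> (ennreal q * emeasure (slot_pmf n (w s)) {b. \<not> success n b}) *
      (\<Prod>r\<in>{..<Suc t}-{s}. emeasure (slot_pmf n (w r)) {b. ?P r b})"
    using assms(2,3)
    by (intro mult_right_mono)
       (auto simp: measure_pmf.emeasure_eq_measure ennreal_mult[symmetric])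
  also have "\<dots> = ennreal q * (\<Prod>r\<in>{..<Suc t}. emeasure (slot_pmf n (w r)) {b. ?P r b})"
    using assms(1) by (subst prod.remove[OF _ s]) (auto simp: mult.assoc)
  finally show ?thesis
    unfolding 1 2 emeasure_slots_Collect[where P="?P"] emeasure_slots_Collect[where P="?Q"] .
qed

text \<open>Linearity of expectation: given the latency, slot \<open>s\<close> is a collision with
  conditional probability at most \<open>q s\<close>.\<close>

lemma expected_collision_cost_le:
  assumes "C \<ge> 0" and lat: "latency n \<omega> = enat (Suc t)"
    and q: "\<And>s. s < t \<Longrightarrow> 0 \<le> q s"
      "\<And>s. s < t \<Longrightarrow> measure (slot_pmf n (window d C \<epsilon> s)) {b. collision n b} \<le>
        q s * measure (slot_pmf n (window d C \<epsilon> s)) {b. \<not> success n b}"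
  shows "expected_collision_cost d C \<epsilon> n \<omega> \<le> ennreal (C * (\<Sum>s<t. q s))"
proof -
  define M where "M = slots n (window d C \<epsilon>)"
  interpret prob_space M unfolding M_def by (rule prob_space_slots)
  define E where "E = {x. latency n x = enat (Suc t)}"
  have E: "E \<in> events" "{x. latency n x = enat (Suc t) \<and> collision n (x s)} \<in> events" for s
  proof -
    have "{x \<in> space M. latency n x = enat (Suc t)} \<in> events"
      "{x \<in> space M. latency n x = enat (Suc t) \<and> collision n (x s)} \<in> events"
      unfolding M_def by measurable
    then show "E \<in> events" "{x. latency n x = enat (Suc t) \<and> collision n (x s)} \<in> events"
      by (auto simp: E_def M_def)
  qed
  have "expected_collision_cost d C \<epsilon> n \<omega> = (\<integral>\<^sup>+x. collision_cost C n x \<partial>uniform_measure M E)"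
    by (simp add: expected_collision_cost_def AH_eq_slots M_def E_def lat)
  also have "\<dots> = (\<integral>\<^sup>+x. collision_cost C n x * indicator E x \<partial>M) / emeasure M E"
    using E by (subst nn_integral_uniform_measure) (auto simp: M_def)
  also have "(\<integral>\<^sup>+x. collision_cost C n x * indicator E x \<partial>M) =
      (\<integral>\<^sup>+x. (\<Sum>s<t. ennreal C * indicator {x. latency n x = enat (Suc t) \<and> collision n (x s)} x) \<partial>M)"
  proof (intro nn_integral_cong)
    fix x
    have "collision_cost C n x = (\<Sum>s<t. ennreal C * indicator {x. latency n x = enat (Suc t) \<and> collision n (x s)} x)"
      if "x \<in> E"
      using that unfolding E_def mem_Collect_eq
      by (subst collision_cost_eq, assumption) (rule sum.cong, auto)
    then show "collision_cost C n x * indicator E x =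
        (\<Sum>s<t. ennreal C * indicator {x. latency n x = enat (Suc t) \<and> collision n (x s)} x)"
      by (cases "x \<in> E") (auto simp: E_def)
  qed
  also have "\<dots> = (\<Sum>s<t. ennreal C * emeasure M {x. latency n x = enat (Suc t) \<and> collision n (x s)})"
    using E by (subst nn_integral_sum) (auto simp: nn_integral_cmult)
  also have "\<dots> \<le> (\<Sum>s<t. ennreal C * (ennreal (q s) * emeasure M E))"
    unfolding M_def E_def
    by (intro sum_mono mult_left_mono emeasure_latency_collision_le q) auto
  also have "\<dots> = (\<Sum>s<t. ennreal (C * q s)) * emeasure M E"
    using assms(1) q(1) by (simp add: sum_distrib_right mult.assoc ennreal_mult)
  also have "(\<Sum>s<t. ennreal (C * q s)) = ennreal (C * (\<Sum>s<t. q s))"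
    using assms(1) q(1) by (subst sum_ennreal) (auto simp: sum_distrib_left)
  finally have "expected_collision_cost d C \<epsilon> n \<omega> \<le>
      (ennreal (C * (\<Sum>s<t. q s)) * emeasure M E) / emeasure M E"
    by (simp add: divide_right_mono_ennreal)
  \<comment> \<open>A latency of probability zero does no harm: the quotient is then 0 / 0, which is
    0 in \<open>ennreal\<close>.\<close>
  also have "\<dots> \<le> ennreal (C * (\<Sum>s<t. q s))"
    by (cases "emeasure M E = 0") (auto simp: ennreal_mult_divide_eq emeasure_eq_measure)
  finally show ?thesis .
qed


subsection \<open>A single slot\<close>

lemma binomial_slot:
  assumes "w \<ge> 1"
  shows "map_pmf (senders n) (slot_pmf n w) = binomial_pmf n (1 / w)"
proof -
  have "binomial_pmf n (1 / w) = map_pmf (\<lambda>f. card {x \<in> {..<n}. f x}) (slot_pmf n w)"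
    unfolding slot_pmf_def using assms by (intro binomial_pmf_altdef') auto
  then show ?thesis by (simp add: senders_def[abs_def] lessThan_def)
qed

lemma prob_senders:
  assumes "w \<ge> 1"
  shows "measure (slot_pmf n w) {b. senders n b = k} =
    real (n choose k) * (1 / w) ^ k * (1 - 1 / w) ^ (n - k)"
proof -
  have "measure (slot_pmf n w) {b. senders n b = k} = pmf (map_pmf (senders n) (slot_pmf n w)) k"
    by (simp add: pmf_map vimage_def)
  then show ?thesis using assms by (simp add: binomial_slot)
qed

lemma prob_success:
  assumes "w \<ge> 1"
  shows "measure (slot_pmf n w) {b. success n b} = real n / w * (1 - 1 / w) ^ (n - 1)"
  using prob_senders[OF assms, of n 1] by (simp add: success_def)

lemma prob_not_success:
  "measure (slot_pmf n w) {b. \<not> success n b} = 1 - measure (slot_pmf n w) {b. success n b}"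
  by (simp add: measure_pmf.prob_compl[symmetric] Compl_eq_Diff_UNIV[symmetric] Collect_neg_eq)

text \<open>By Bernoulli's inequality, the \<open>n - 1\<close> other packets are all silent with
  probability at least 1/2.\<close>

lemma prob_success_ge:
  assumes "n \<ge> 1" "w \<ge> 2 * real n"
  shows "measure (slot_pmf n w) {b. success n b} \<ge> real n / (2 * w)"
proof -
  have w: "w \<ge> 2" using assms by linarith
  have "1 / 2 \<le> 1 + real (n - 1) * (- 1 / w)"
    using assms w by (simp add: field_simps of_nat_diff)
  also have "\<dots> \<le> (1 + (- 1 / w)) ^ (n - 1)"
    using w by (intro Bernoulli_inequality) (simp add: field_simps)
  finally have "real n / w * (1 / 2) \<le> real n / w * (1 - 1 / w) ^ (n - 1)"
    using w by (intro mult_left_mono) auto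
  then show ?thesis using w by (simp add: prob_success)
qed

text \<open>A collision has probability at most \<open>(n / w)\<^sup>2\<close>, and no success has
  probability at least 1/2, whence the factor 2.\<close>

lemma prob_collision_le:
  assumes "n \<ge> 1" "w \<ge> 2 * real n"
  shows "measure (slot_pmf n w) {b. collision n b} \<le>
    2 * (real n / w)\<^sup>2 * measure (slot_pmf n w) {b. \<not> success n b}"
proof -
  have w: "w \<ge> 2" using assms by linarith
  have s: "measure (slot_pmf n w) {b. success n b} \<le> 1 / 2"
  proof -
    have "(1 - 1 / w) ^ (n - 1) \<le> 1" using w by (intro power_le_one) auto
    then have "real n / w * (1 - 1 / w) ^ (n - 1) \<le> real n / w * 1"
      using w by (intro mult_left_mono) auto
    also have "\<dots> \<le> 1 / 2" using assms w by (simp add: field_simps)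
    finally show ?thesis using w by (simp add: prob_success)
  qed
  have b: "1 - real m / w \<le> (1 - 1 / w) ^ m" for m
    using Bernoulli_inequality[of "- 1 / w" m] w by (simp add: field_simps)
  have "{b. collision n b} = UNIV - ({b. senders n b = 0} \<union> {b. success n b})"
    by (auto simp: collision_def success_def)
  then have "measure (slot_pmf n w) {b. collision n b} =
      1 - measure (slot_pmf n w) ({b. senders n b = 0} \<union> {b. success n b})"
    using measure_pmf.prob_compl[of "{b. senders n b = 0} \<union> {b. success n b}" "slot_pmf n w"]
    by simp
  also have "\<dots> = 1 - (1 - 1 / w) ^ n - real n / w * (1 - 1 / w) ^ (n - 1)"
    using w by (subst measure_pmf.finite_measure_Union) (auto simp: success_def[abs_def] prob_senders)
  \<comment> \<open>Bernoulli's inequality bounds both powers from below; the terms linear in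
    \<open>1 / w\<close> then cancel.\<close>
  also have "\<dots> \<le> 1 - (1 - real n / w) - real n / w * (1 - real (n - 1) / w)"
    using w by (intro diff_mono b order.refl mult_left_mono) auto
  also have "\<dots> = real n / w * (real (n - 1) / w)"
    by (simp add: algebra_simps)
  also have "\<dots> \<le> real n / w * (real n / w)"
    using w by (intro mult_left_mono divide_right_mono) auto
  also have "\<dots> = 2 * (real n / w)\<^sup>2 * (1 / 2)"
    by (simp add: power2_eq_square)
  also have "\<dots> \<le> 2 * (real n / w)\<^sup>2 * measure (slot_pmf n w) {b. \<not> success n b}"
    using s by (intro mult_left_mono) (auto simp: prob_not_success)
  finally show ?thesis .
qed


subsection \<open>The schedule of samples\<close>

text \<open>The states at the beginnings of successive samples. Setting the slot counter to 1 makes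
  \<open>next_slot\<close> leave the current sample at once, whatever its length.\<close>

primrec sample :: "real \<Rightarrow> real \<Rightarrow> real \<Rightarrow> nat \<Rightarrow> ah_state" where
  "sample d C \<epsilon> 0 = halving_test d C (2 powr (C powr \<epsilon>))"
| "sample d C \<epsilon> (Suc j) = (case sample d C \<epsilon> j of (ph, w, r) \<Rightarrow> next_slot d C (ph, w, 1))"

definition sample_window :: "real \<Rightarrow> real \<Rightarrow> real \<Rightarrow> nat \<Rightarrow> real" where
  "sample_window d C \<epsilon> j = fst (snd (sample d C \<epsilon> j))"

definition sample_length :: "real \<Rightarrow> real \<Rightarrow> real \<Rightarrow> nat \<Rightarrow> nat" where
  "sample_length d C \<epsilon> j = snd (snd (sample d C \<epsilon> j))"

definition sample_start :: "real \<Rightarrow> real \<Rightarrow> real \<Rightarrow> nat \<Rightarrow> nat" where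
  "sample_start d C \<epsilon> j = (\<Sum>i<j. sample_length d C \<epsilon> i)"

lemma sample_start_Suc:
  "sample_start d C \<epsilon> (Suc j) = sample_start d C \<epsilon> j + sample_length d C \<epsilon> j"
  by (simp add: sample_start_def)

text \<open>Windows of at least 2 have a positive logarithm, so rounding up gives at least one slot
  per sample. This is needed to match samples with iterates of \<open>next_slot\<close>.\<close>

lemma sample_pos:
  assumes "d > 0" "C > 0"
  shows "sample_window d C \<epsilon> j \<ge> 2 \<and> sample_length d C \<epsilon> j > 0"
proof (induction j)
  case 0
  then show ?case
    using assms
    by (auto simp: sample_window_def sample_length_def halving_test_def large_sample_def
        small_sample_def)
next
  case (Suc j)
  obtain ph w r where s: "sample d C \<epsilon> j = (ph, w, r)" by (rule prod_cases3)
  with Suc have "w \<ge> 2" by (simp add: sample_window_def)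
  then show ?case
    using assms s
    by (cases ph)
       (auto simp: sample_window_def sample_length_def halving_test_def large_sample_def
        small_sample_def)
qed

lemma next_slot_funpow: "t < r \<Longrightarrow> (next_slot d C ^^ t) (ph, w, r) = (ph, w, r - t)"
  by (induction t) auto

text \<open>The link between slots and samples: a sample of \<open>r\<close> slots is
  \<open>r - 1\<close> decrements of the counter followed by one jump to the next sample.\<close>

lemma funpow_sample_start:
  assumes "d > 0" "C > 0"
  shows "(next_slot d C ^^ sample_start d C \<epsilon> j) (halving_test d C (2 powr (C powr \<epsilon>))) =
    sample d C \<epsilon> j"
proof (induction j)
  case (Suc j)
  obtain ph w r where s: "sample d C \<epsilon> j = (ph, w, r)" by (rule prod_cases3)
  have "r > 0" using sample_pos[OF assms, of \<epsilon> j] s by (simp add: sample_length_def)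
  then obtain r' where r: "r = Suc r'" by (cases r) auto
  have "(next_slot d C ^^ Suc r') (ph, w, r) = next_slot d C (ph, w, 1)"
    using next_slot_funpow[of r' r d C ph w] r by simp
  moreover have "sample_start d C \<epsilon> (Suc j) = Suc r' + sample_start d C \<epsilon> j"
    using s r by (simp add: sample_start_Suc sample_length_def)
  ultimately show ?case
    using Suc s by (simp only: funpow_add o_apply sample.simps prod.case)
qed (simp add: sample_start_def)

lemma window_sample:
  assumes "d > 0" "C > 0" "t < sample_length d C \<epsilon> j"
  shows "window d C \<epsilon> (sample_start d C \<epsilon> j + t) = sample_window d C \<epsilon> j"
proof -
  obtain ph w r where s: "sample d C \<epsilon> j = (ph, w, r)" by (rule prod_cases3)
  have "window d C \<epsilon> (t + sample_start d C \<epsilon> j) = fst (snd ((next_slot d C ^^ t) (ph, w, r)))"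
    using funpow_sample_start[OF assms(1,2), of \<epsilon> j] by (simp add: window_def funpow_add s)
  with assms(3) s show ?thesis
    by (simp add: sample_length_def sample_window_def next_slot_funpow add.commute)
qed

lemma sum_window:
  fixes f :: "real \<Rightarrow> real"
  assumes "d > 0" "C > 0"
  shows "(\<Sum>t<sample_start d C \<epsilon> j. f (window d C \<epsilon> t)) =
    (\<Sum>i<j. real (sample_length d C \<epsilon> i) * f (sample_window d C \<epsilon> i))"
proof (induction j)
  case (Suc j)
  have split: "(\<Sum>t<a + b. g t) = (\<Sum>t<a. g t) + (\<Sum>t<b. g (a + t))" for a b and g :: "nat \<Rightarrow> real"
    by (induction b) (auto simp: add.assoc)
  show ?case
    by (simp add: sample_start_Suc split Suc window_sample[OF assms])
qed (simp add: sample_start_def)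

lemma ex_sample:
  assumes "d > 0" "C > 0" "t < sample_start d C \<epsilon> j"
  shows "\<exists>i<j. window d C \<epsilon> t = sample_window d C \<epsilon> i"
  using assms(3)
proof (induction j)
  case (Suc j)
  show ?case
  proof (cases "t < sample_start d C \<epsilon> j")
    case True
    with Suc.IH less_SucI show ?thesis by blast
  next
    case False
    then obtain u where "t = sample_start d C \<epsilon> j + u"
      using le_Suc_ex not_less by blast
    with Suc.prems window_sample[OF assms(1,2)] show ?thesis
      by (auto simp: sample_start_Suc)
  qed
qed (simp add: sample_start_def)

text \<open>Only sample \<open>j\<close> is used: the failure probabilities of all earlier slots are
  bounded by 1, and each slot of the sample fails with probability at most
  \<open>exp (- n / (2 * w))\<close>.\<close>

lemma prob_latency_le_sample:
  assumes "d > 0" "C > 0" "n \<ge> 1" "sample_window d C \<epsilon> j \<ge> 2 * real n"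
  shows "measure (AH d C \<epsilon> n) {\<omega>. latency n \<omega> \<le> enat (sample_start d C \<epsilon> (Suc j))} \<ge>
    1 - exp (- (real (sample_length d C \<epsilon> j) * (real n / (2 * sample_window d C \<epsilon> j))))"
proof -
  let ?w = "window d C \<epsilon>" and ?W = "sample_window d C \<epsilon> j" and ?r = "sample_length d C \<epsilon> j"
  let ?f = "\<lambda>s. 1 - measure (slot_pmf n (?w s)) {b. success n b}"
  have f: "0 \<le> ?f s" "?f s \<le> 1" for s by auto
  have split: "(\<Prod>t<a + b. g t) = (\<Prod>t<a. g t) * (\<Prod>t<b. g (a + t))" for a b and g :: "nat \<Rightarrow> real"
    by (induction b) (auto simp: mult.assoc)
  have "(\<Prod>s<sample_start d C \<epsilon> (Suc j). ?f s) \<le> 1 * (\<Prod>t<?r. ?f (sample_start d C \<epsilon> j + t))"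
    unfolding sample_start_Suc split
    by (intro mult_right_mono prod_le_1 prod_nonneg) (auto simp: f)
  also have "\<dots> = (1 - measure (slot_pmf n ?W) {b. success n b}) ^ ?r"
    by (simp add: window_sample[OF assms(1,2)])
  also have "\<dots> \<le> exp (- (real n / (2 * ?W))) ^ ?r"
  proof (intro power_mono)
    have "1 - measure (slot_pmf n ?W) {b. success n b} \<le> 1 + - (real n / (2 * ?W))"
      using prob_success_ge[OF assms(3,4)] by simp
    also have "\<dots> \<le> exp (- (real n / (2 * ?W)))"
      by (rule exp_ge_add_one_self)
    finally show "1 - measure (slot_pmf n ?W) {b. success n b} \<le> exp (- (real n / (2 * ?W)))" .
  qed simp
  also have "\<dots> = exp (- (real ?r * (real n / (2 * ?W))))"
    by (simp add: exp_of_nat_mult[symmetric])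
  finally show ?thesis
    unfolding AH_eq_slots prob_latency_le by simp
qed

text \<open>The hypothesis says that the initial window halved \<open>j\<close> times is still at
  least 2, so the halving phase is not over.\<close>

lemma sample_halving:
  assumes "real (Suc j) \<le> C powr \<epsilon>"
  shows "sample d C \<epsilon> j =
    (Halving, 2 powr (C powr \<epsilon> - real j), large_sample d C (2 powr (C powr \<epsilon> - real j)))"
  using assms
proof (induction j)
  case 0
  then have "2 powr 1 \<le> (2::real) powr (C powr \<epsilon>)" by (intro powr_mono) auto
  then show ?case by (simp add: halving_test_def)
next
  case (Suc j)
  then have "2 powr 1 \<le> (2::real) powr (C powr \<epsilon> - real (Suc j))" by (intro powr_mono) auto
  moreover have "2 powr (C powr \<epsilon> - real j) / 2 = (2::real) powr (C powr \<epsilon> - real (Suc j))"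
    by (simp add: powr_diff powr_add field_simps)
  ultimately show ?case using Suc by (simp add: halving_test_def)
qed

lemma sample_doubling:
  assumes "1 \<le> C powr \<epsilon>"
  shows "sample d C \<epsilon> (nat \<lfloor>C powr \<epsilon>\<rfloor> + i) = (Doubling, 4 * 2 ^ i, small_sample d (4 * 2 ^ i))"
proof (induction i)
  case 0
  \<comment> \<open>The last sample of the halving phase: its window is below 4, so the next halving
    falls below 2 and starts the doubling phase.\<close>
  define j where "j = nat \<lfloor>C powr \<epsilon>\<rfloor> - 1"
  have j: "nat \<lfloor>C powr \<epsilon>\<rfloor> = Suc j" "real (Suc j) \<le> C powr \<epsilon>" "C powr \<epsilon> < real (Suc j) + 1"
    using assms unfolding j_def by linarith+
  have "2 powr (C powr \<epsilon> - real j) < (2::real) powr 2" using j by (intro powr_less_mono) auto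
  then have "2 powr (C powr \<epsilon> - real j) / 2 < (2::real)" by simp
  then show ?case using sample_halving[OF j(2), of d] j(1) by (simp add: halving_test_def)
next
  case (Suc i)
  then show ?case by simp
qed

lemma real_nat_ceiling_le: "0 \<le> x \<Longrightarrow> real (nat \<lceil>x\<rceil>) \<le> x + 1"
  by linarith

lemma sample_length_halving_le:
  assumes "d > 0" "C > 0" "real (Suc j) \<le> C powr \<epsilon>"
  shows "real (sample_length d C \<epsilon> j) \<le> d * C powr (1 / 2 + \<epsilon>) + 1"
proof -
  let ?x = "C powr \<epsilon> - real j"
  have "ln (2 powr ?x) = ?x * ln 2" by (simp add: ln_powr)
  also have "\<dots> \<le> C powr \<epsilon> * 1"
    using assms ln_2_less_1 by (intro mult_mono) auto
  finally have "d * sqrt C * ln (2 powr ?x) \<le> d * sqrt C * C powr \<epsilon>"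
    using assms by (intro mult_left_mono) auto
  moreover have "0 \<le> d * sqrt C * ln (2 powr ?x)"
    using assms by (simp add: ln_powr)
  ultimately have "real (large_sample d C (2 powr ?x)) \<le> d * sqrt C * C powr \<epsilon> + 1"
    unfolding large_sample_def using real_nat_ceiling_le[of "d * sqrt C * ln (2 powr ?x)"] by linarith
  moreover have "sqrt C * C powr \<epsilon> = C powr (1 / 2 + \<epsilon>)"
    using assms by (simp add: powr_add powr_half_sqrt)
  ultimately show ?thesis
    by (simp add: sample_length_def sample_halving[OF assms(3)] mult.assoc)
qed

text \<open>One \<epsilon> in the exponent comes from the logarithm of the window in the sample
  length, the other from the number of samples. The slot lost to rounding in each sample turns
  \<open>d\<close> into \<open>d + 1\<close>.\<close>

lemma sample_start_halving_le:
  assumes "d > 0" "C \<ge> 1" "\<epsilon> > 0" "real j \<le> C powr \<epsilon>"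
  shows "real (sample_start d C \<epsilon> j) \<le> (d + 1) * C powr (1 / 2 + 2 * \<epsilon>)"
proof -
  have "real (sample_start d C \<epsilon> j) \<le> (\<Sum>i<j. d * C powr (1 / 2 + \<epsilon>) + 1)"
    unfolding sample_start_def of_nat_sum using assms
    by (intro sum_mono sample_length_halving_le) auto
  also have "\<dots> = real j * (d * C powr (1 / 2 + \<epsilon>) + 1)" by simp
  also have "\<dots> \<le> C powr \<epsilon> * (d * C powr (1 / 2 + \<epsilon>) + C powr (1 / 2 + \<epsilon>))"
    using assms by (intro mult_mono add_mono ge_one_powr_ge_zero) auto
  also have "\<dots> = (d + 1) * C powr (1 / 2 + 2 * \<epsilon>)"
    by (simp add: algebra_simps flip: powr_add)
  finally show ?thesis .
qed


subsection \<open>The two regimes\<close>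

text \<open>
  The decisive sample is the one whose window \<open>w\<close> is between \<open>n * sqrt C\<close> and \<open>2 * n * sqrt C\<close>: each
  of its \<open>d * sqrt C * ln w\<close> slots is a success with probability at least \<open>1 / (4 * sqrt C)\<close>. The
  expected numbers of collisions in the samples up to it are dominated by a geometric series of
  ratio \<open>1 / 4\<close>.
\<close>

lemma halving_regime:
  assumes a: "a > 0" and d: "d \<ge> 8 * a" and \<epsilon>: "\<epsilon> > 0" and n: "n \<ge> 1" and C: "C \<ge> 4"
    and W: "real n * sqrt C \<le> 2 powr (C powr \<epsilon>)"
  obtains T where "real T \<le> (d + 1) * C powr (1 / 2 + 2 * \<epsilon>)"
    "measure (AH d C \<epsilon> n) {\<omega>. latency n \<omega> \<le> enat T} \<ge> 1 - 1 / max (real n) C powr a"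
    "\<And>\<omega>. latency n \<omega> \<le> enat T \<Longrightarrow>
      expected_collision_cost d C \<epsilon> n \<omega> \<le> ennreal (4 * (d + 1) * C powr (1 / 2 + 2 * \<epsilon>))"
proof -
  define x where "x = C powr \<epsilon>"
  define W where "W = real n * sqrt C"
  have d0: "d > 0" and C0: "C > 0" using a d C by linarith+
  have s2: "sqrt C \<ge> 2" using C by (simp add: real_le_rsqrt)
  have W2n: "2 * real n \<le> W" unfolding W_def using s2 by (simp add: mult.commute mult_left_mono)
  have Wge2: "W \<ge> 2" using W2n n by linarith
  have lW: "1 \<le> log 2 W" using Wge2 by (simp add: le_log_iff)
  have Wx: "log 2 W \<le> x" using W Wge2 by (simp add: log_le_iff W_def x_def)
  \<comment> \<open>The last sample whose window is at least \<open>W\<close>. As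
    \<open>log 2 W\<close> is at least 1, it still belongs to the halving phase.\<close>
  define J where "J = nat \<lfloor>x - log 2 W\<rfloor>"
  have J: "real J \<le> x - log 2 W" "x - log 2 W < real J + 1" "real (Suc J) \<le> x"
    unfolding J_def using Wx lW by linarith+
  define w where "w i = 2 powr (x - real i)" for i
  have win: "sample_window d C \<epsilon> i = w i"
    and len: "sample_length d C \<epsilon> i = large_sample d C (w i)" if "i \<le> J" for i
    using sample_halving[of i C \<epsilon> d] that J(3)
    by (auto simp: sample_window_def sample_length_def w_def x_def)
  have WJ: "W \<le> w J"
  proof -
    have "2 powr log 2 W \<le> w J" unfolding w_def using J by (intro powr_mono) auto
    then show ?thesis using Wge2 by simp
  qed
  have WJ2: "w J \<le> 2 * W"
  proof -
    have "w J \<le> 2 powr (1 + log 2 W)" unfolding w_def using J by (intro powr_mono) auto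
    then show ?thesis using Wge2 by (simp add: powr_add)
  qed
  have wi: "w i = w J * 2 ^ (J - i)" if "i \<le> J" for i
  proof -
    have "x - real i = x - real J + real (J - i)" using that by simp
    then show ?thesis unfolding w_def by (simp only: powr_add powr_realpow)
  qed
  have wiW: "W \<le> w i" if "i \<le> J" for i
  proof -
    have "w J \<le> w i" unfolding w_def using that by (intro powr_mono) auto
    with WJ show ?thesis by linarith
  qed
  define T where "T = sample_start d C \<epsilon> (Suc J)"
  show ?thesis
  proof
    show "real T \<le> (d + 1) * C powr (1 / 2 + 2 * \<epsilon>)"
      unfolding T_def using d0 C \<epsilon> J(3) by (intro sample_start_halving_le) (auto simp: x_def)
    show "measure (AH d C \<epsilon> n) {\<omega>. latency n \<omega> \<le> enat T} \<ge> 1 - 1 / max (real n) C powr a"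
    proof -
      let ?\<eta> = "max (real n) C"
      \<comment> \<open>This makes the failure probability polynomially small in \<eta> and not only
        in \<open>n\<close>: the sample length is proportional to \<open>ln (w J)\<close>, which is
        at least half of \<open>ln \<eta>\<close>.\<close>
      have "?\<eta> \<le> W\<^sup>2"
      proof -
        have "real n * 1 \<le> real n * (real n * C)" "1 * C \<le> (real n * real n) * C"
          using n C by (intro mult_left_mono mult_right_mono mult_ge1_I; simp)+
        then show ?thesis using C by (simp add: W_def power2_eq_square algebra_simps)
      qed
      then have "ln ?\<eta> \<le> ln (W\<^sup>2)" using C by (intro ln_mono) auto
      also have "\<dots> = 2 * ln W" using Wge2 by (simp add: ln_realpow)
      also have "\<dots> \<le> 2 * ln (w J)" using WJ Wge2 by simp
      finally have l: "ln ?\<eta> \<le> 2 * ln (w J)" .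
      have le0: "0 \<le> ln ?\<eta>" using C by simp
      \<comment> \<open>The 8 in \<open>d \<ge> 8 * a\<close> is 2 from this logarithm times 4 from
        the success probability, which is at least \<open>n / (4 * W)\<close>.\<close>
      have "a * ln ?\<eta> \<le> (d / 8) * (2 * ln (w J))"
        using d l le0 a by (intro mult_mono) auto
      also have "\<dots> = (d * sqrt C * ln (w J)) * (real n / (4 * W))"
        using n C0 by (simp add: W_def field_simps)
      also have "\<dots> \<le> real (large_sample d C (w J)) * (real n / (2 * w J))"
      proof (intro mult_mono)
        show "d * sqrt C * ln (w J) \<le> real (large_sample d C (w J))"
          unfolding large_sample_def by linarith
        show "real n / (4 * W) \<le> real n / (2 * w J)"
          using WJ WJ2 Wge2 by (intro divide_left_mono) auto
      qed (use Wge2 in auto)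
      finally have e: "exp (- (real (large_sample d C (w J)) * (real n / (2 * w J)))) \<le> exp (- (a * ln ?\<eta>))"
        by simp
      also have "\<dots> = 1 / ?\<eta> powr a"
        using C by (simp add: powr_def exp_minus field_simps)
      finally show ?thesis
        using prob_latency_le_sample[OF d0 C0 n, of \<epsilon> J] win[of J] len[of J] WJ W2n
        unfolding T_def by simp
    qed
    fix \<omega> assume lat: "latency n \<omega> \<le> enat T"
    then obtain t where t: "latency n \<omega> = enat (Suc t)" "Suc t \<le> T"
      by (cases n \<omega> rule: latency_cases) auto
    define q where "q v = 2 * (real n / v)\<^sup>2" for v :: real
    define R where "R = d * C powr (1 / 2 + \<epsilon>) + 1"
    have R0: "0 \<le> R" unfolding R_def using d0 by simp
    have q0: "0 \<le> q v" for v by (simp add: q_def)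
    have "expected_collision_cost d C \<epsilon> n \<omega> \<le> ennreal (C * (\<Sum>s<t. q (window d C \<epsilon> s)))"
    proof (rule expected_collision_cost_le[OF _ t(1)])
      fix s assume "s < t"
      with t(2) obtain i where i: "i \<le> J" "window d C \<epsilon> s = w i"
        using ex_sample[OF d0 C0, of s \<epsilon> "Suc J"] win unfolding T_def
        by (metis less_Suc_eq_le less_trans less_le_trans lessI)
      then have "2 * real n \<le> window d C \<epsilon> s" using wiW W2n by fastforce
      with n show "measure (slot_pmf n (window d C \<epsilon> s)) {b. collision n b} \<le>
          q (window d C \<epsilon> s) * measure (slot_pmf n (window d C \<epsilon> s)) {b. \<not> success n b}"
        unfolding q_def by (rule prob_collision_le)
    qed (use C q0 in auto)
    also have "\<dots> \<le> ennreal (4 * (d + 1) * C powr (1 / 2 + 2 * \<epsilon>))"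
    proof (rule ennreal_leI)
      have "(\<Sum>s<t. q (window d C \<epsilon> s)) \<le> (\<Sum>s<T. q (window d C \<epsilon> s))"
        using t(2) q0 by (intro sum_mono2) auto
      also have "\<dots> = (\<Sum>i<Suc J. real (sample_length d C \<epsilon> i) * q (sample_window d C \<epsilon> i))"
        unfolding T_def by (rule sum_window[OF d0 C0])
      \<comment> \<open>Going back one sample doubles the window and so divides the collision bound
        by 4; at window \<open>W\<close> it is \<open>2 / C\<close>.\<close>
      also have "\<dots> \<le> (\<Sum>i<Suc J. R * (2 / C * (1 / 4) ^ (J - i)))"
      proof (intro sum_mono mult_mono)
        fix i assume "i \<in> {..<Suc J}"
        then have i: "i \<le> J" by simp
        show "real (sample_length d C \<epsilon> i) \<le> R"
          unfolding R_def using d0 C0 J(3) i by (intro sample_length_halving_le) (auto simp: x_def)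
        have "real n / w i \<le> real n / (W * 2 ^ (J - i))"
          unfolding wi[OF i] using WJ Wge2 by (intro divide_left_mono mult_right_mono) auto
        then have "(real n / w i)\<^sup>2 \<le> (real n / (W * 2 ^ (J - i)))\<^sup>2"
          using wiW[OF i] Wge2 by (intro power_mono) auto
        also have "\<dots> = 1 / C * (1 / 4) ^ (J - i)"
        proof -
          have "((2::real) ^ (J - i))\<^sup>2 = 4 ^ (J - i)"
            by (simp add: power_mult[symmetric] mult.commute[of _ 2]) (simp add: power_mult)
          then show ?thesis
            using n C by (simp add: W_def power_divide power_mult_distrib)
        qed
        finally show "q (sample_window d C \<epsilon> i) \<le> 2 / C * (1 / 4) ^ (J - i)"
          unfolding q_def win[OF i] by simp
      qed (use R0 q0 C in auto)
      also have "\<dots> = 2 * R / C * (\<Sum>i<Suc J. (1 / 4) ^ (J - i))"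
        unfolding sum_distrib_left by (intro sum.cong) auto
      also have "(\<Sum>i<Suc J. (1 / 4 :: real) ^ (J - i)) = (\<Sum>i<Suc J. (1 / 4) ^ i)"
        by (rule sum.nat_diff_reindex[of "\<lambda>i. (1 / 4 :: real) ^ i" "Suc J", simplified diff_Suc_Suc])
      also have "2 * R / C * (\<Sum>i<Suc J. (1 / 4) ^ i) \<le> 2 * R / C * 2"
      proof (intro mult_left_mono)
        have "(\<Sum>i<Suc J. (1 / 4 :: real) ^ i) = (1 - (1 / 4) ^ Suc J) / (1 - 1 / 4)"
          by (subst sum_gp_strict) auto
        also have "\<dots> \<le> 2"
        proof -
          have *: "(1 - y) / (1 - 1 / 4) \<le> 2" if "0 \<le> y" for y :: real
            using that by simp
          show ?thesis by (rule *) simp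
        qed
        finally show "(\<Sum>i<Suc J. (1 / 4 :: real) ^ i) \<le> 2" .
      qed (use R0 C in auto)
      finally have "C * (\<Sum>s<t. q (window d C \<epsilon> s)) \<le> C * (2 * R / C * 2)"
        using C0 by (intro mult_left_mono) auto
      \<comment> \<open>The cost of a collision cancels against
        \<open>(n / W)\<^sup>2 = 1 / C\<close>; what remains is the bound on the length of a single
        sample.\<close>
      also have "\<dots> = 4 * R" using C0 by simp
      also have "R \<le> d * C powr (1 / 2 + 2 * \<epsilon>) + C powr (1 / 2 + 2 * \<epsilon>)"
        unfolding R_def using d0 C \<epsilon>
        by (intro add_mono mult_left_mono powr_mono ge_one_powr_ge_zero) auto
      finally show "C * (\<Sum>s<t. q (window d C \<epsilon> s)) \<le> 4 * (d + 1) * C powr (1 / 2 + 2 * \<epsilon>)"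
        by (simp add: algebra_simps)
    qed
    finally show "expected_collision_cost d C \<epsilon> n \<omega> \<le>
        ennreal (4 * (d + 1) * C powr (1 / 2 + 2 * \<epsilon>))" .
  qed
qed

text \<open>The halving phase is only charged for its length, whether or not its windows ever reach
  the order of \<open>n\<close>. The success comes from one doubling sample with window between
  \<open>2 * n\<close> and \<open>4 * n\<close>.\<close>

lemma doubling_regime:
  assumes a: "a > 0" and d: "d \<ge> 8 * a" and \<epsilon>: "\<epsilon> > 0" and n: "n \<ge> 4" and C: "C \<ge> 4"
  obtains T where "real T \<le> (d + 1) * C powr (1 / 2 + 2 * \<epsilon>) + 9 * (d + 1) * (ln (real n))\<^sup>2"
    "measure (AH d C \<epsilon> n) {\<omega>. latency n \<omega> \<le> enat T} \<ge> 1 - 1 / real n powr a"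
proof -
  define N where "N = nat \<lfloor>C powr \<epsilon>\<rfloor>"
  define L where "L = ln (real n)"
  have d0: "d > 0" and C0: "C > 0" using a d C by linarith+
  have x: "1 \<le> C powr \<epsilon>" using C \<epsilon> by (intro ge_one_powr_ge_zero) auto
  have N: "real N \<le> C powr \<epsilon>" unfolding N_def using x by linarith
  have L1: "1 \<le> L"
  proof -
    have "exp 1 \<le> real n" using exp_le n by linarith
    then show ?thesis using n by (simp add: L_def ln_ge_iff)
  qed
  \<comment> \<open>The first doubling sample with window \<open>4 * 2 ^ I\<close> at least
    \<open>2 * n\<close>; rounding up at most doubles it.\<close>
  define I where "I = nat \<lceil>log 2 (real n / 2)\<rceil>"
  have l0: "1 \<le> log 2 (real n / 2)" using n by (simp add: le_log_iff)
  have I: "log 2 (real n / 2) \<le> real I" "real I \<le> log 2 (real n / 2) + 1"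
    unfolding I_def using l0 by linarith+
  have lo: "real n / 2 \<le> 2 ^ I"
  proof -
    have "2 powr log 2 (real n / 2) \<le> 2 powr real I" using I by (intro powr_mono) auto
    then show ?thesis using n by (simp add: powr_realpow)
  qed
  have hi: "2 ^ I \<le> real n"
  proof -
    have "2 powr real I \<le> 2 powr (log 2 (real n / 2) + 1)" using I by (intro powr_mono) auto
    then show ?thesis using n by (simp add: powr_realpow powr_add)
  qed
  have smp: "sample_window d C \<epsilon> (N + i) = 4 * 2 ^ i"
    "sample_length d C \<epsilon> (N + i) = small_sample d (4 * 2 ^ i)" for i
    using sample_doubling[OF x, of d i] by (auto simp: sample_window_def sample_length_def N_def)
  define T where "T = sample_start d C \<epsilon> (Suc (N + I))"
  show ?thesis
  proof
    have split: "(\<Sum>t<u + v. g t) = (\<Sum>t<u. g t) + (\<Sum>t<v. g (u + t))" for u v and g :: "nat \<Rightarrow> nat"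
      by (induction v) (auto simp: add.assoc)
    have len: "real (small_sample d (4 * 2 ^ i)) \<le> 3 * (d + 1) * L" if "i \<le> I" for i
    proof -
      have "(2::real) ^ i \<le> 2 ^ I" using that by (intro power_increasing) auto
      with hi have "4 * 2 ^ i \<le> 4 * real n" by linarith
      then have "ln (4 * 2 ^ i) \<le> ln (4 * real n)" by (intro ln_mono) auto
      also have "\<dots> = 2 * ln 2 + L" using n ln_realpow[of 2 2] by (simp add: ln_mult L_def)
      also have "\<dots> \<le> 3 * L" using L1 ln_2_less_1 by linarith
      finally have "d * ln (4 * 2 ^ i) \<le> d * (3 * L)" using d0 by (intro mult_left_mono) auto
      moreover have "0 \<le> d * ln (4 * 2 ^ i)"
        using d0 two_realpow_ge_one[of i] by (intro mult_nonneg_nonneg ln_ge_zero) linarith+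
      ultimately have "real (small_sample d (4 * 2 ^ i)) \<le> d * (3 * L) + 1"
        unfolding small_sample_def using real_nat_ceiling_le[of "d * ln (4 * 2 ^ i)"] by linarith
      also have "\<dots> \<le> 3 * (d + 1) * L" using L1 by (simp add: algebra_simps)
      finally show ?thesis .
    qed
    have SI: "real (Suc I) \<le> 3 * L"
    proof -
      have "log 2 (real n / 2) = log 2 (real n) - 1" using n by (simp add: log_divide)
      with I have "real (Suc I) \<le> log 2 (real n) + 1" by simp
      also have "log 2 (real n) \<le> 2 * L"
      proof -
        \<comment> \<open>From \<open>ln x \<le> x - 1\<close> at \<open>x = 1 / 2\<close>.\<close>
        have "1 / 2 \<le> ln (2::real)" using ln_le_minus_one[of "1 / 2 :: real"] by (simp add: ln_div)
        then have "L * 1 \<le> L * (2 * ln 2)" using L1 by (intro mult_left_mono) auto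
        then show ?thesis by (simp add: log_def L_def field_simps)
      qed
      finally show ?thesis using L1 by linarith
    qed
    have "T = sample_start d C \<epsilon> N + (\<Sum>i<Suc I. sample_length d C \<epsilon> (N + i))"
      unfolding T_def sample_start_def add_Suc_right[symmetric] by (rule split)
    then have "real T = real (sample_start d C \<epsilon> N) + (\<Sum>i<Suc I. real (small_sample d (4 * 2 ^ i)))"
      by (simp only: smp of_nat_add of_nat_sum)
    also have "\<dots> \<le> (d + 1) * C powr (1 / 2 + 2 * \<epsilon>) + (\<Sum>i<Suc I. 3 * (d + 1) * L)"
      using d0 C \<epsilon> N by (intro add_mono sum_mono len sample_start_halving_le) auto
    also have "(\<Sum>i<Suc I. 3 * (d + 1) * L) = real (Suc I) * (3 * (d + 1) * L)"
      by simp
    \<comment> \<open>At most \<open>3 * L\<close> doubling samples of length at most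
      \<open>3 * (d + 1) * L\<close>, whence the constant 9.\<close>
    also have "\<dots> \<le> (3 * L) * (3 * (d + 1) * L)"
      using SI L1 d0 by (intro mult_right_mono) auto
    finally show "real T \<le> (d + 1) * C powr (1 / 2 + 2 * \<epsilon>) + 9 * (d + 1) * (ln (real n))\<^sup>2"
      by (simp add: L_def power2_eq_square algebra_simps)
    show "measure (AH d C \<epsilon> n) {\<omega>. latency n \<omega> \<le> enat T} \<ge> 1 - 1 / real n powr a"
    proof -
      let ?w = "4 * 2 ^ I :: real"
      \<comment> \<open>Here the 8 comes from the success probability \<open>n / (2 * w)\<close>
        with \<open>w \<le> 4 * n\<close>.\<close>
      have "a * L \<le> (d * ln ?w) * (1 / 8)"
      proof -
        have "L \<le> ln ?w" unfolding L_def using lo n by (intro ln_mono) auto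
        then have "a * L \<le> (d / 8) * ln ?w" using d a L1 by (intro mult_mono) auto
        then show ?thesis by simp
      qed
      also have "\<dots> \<le> real (small_sample d ?w) * (real n / (2 * ?w))"
      proof (intro mult_mono)
        show "d * ln ?w \<le> real (small_sample d ?w)" unfolding small_sample_def by linarith
        show "1 / 8 \<le> real n / (2 * ?w)" using hi by (simp add: field_simps)
      qed auto
      finally have "exp (- (real (small_sample d ?w) * (real n / (2 * ?w)))) \<le> exp (- (a * L))"
        by simp
      also have "\<dots> = 1 / real n powr a"
        using n by (simp add: powr_def exp_minus field_simps L_def)
      finally show ?thesis
        using prob_latency_le_sample[OF d0 C0, of n \<epsilon> "N + I"] n lo
        unfolding T_def smp by simp
    qed
  qed
qed

section \<open>Transfer from the latency event to the other events\<close>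

lemma measurable_expected_collision_cost [measurable]:
  "expected_collision_cost d C \<epsilon> n \<in> borel_measurable (slots m w)"
proof -
  \<comment> \<open>The value depends on the outcome only through its latency, that is, it factors
    through a discrete space.\<close>
  have "expected_collision_cost d C \<epsilon> n = (\<lambda>l. \<integral>\<^sup>+ x. collision_cost C n x
      \<partial>uniform_measure (AH d C \<epsilon> n) {x \<in> space (AH d C \<epsilon> n). latency n x = l}) \<circ> latency n"
    by (simp add: fun_eq_iff expected_collision_cost_def)
  then show ?thesis
    by (simp add: measurable_comp[OF measurable_latency])
qed

text \<open>The trivial case \<open>q s = 1\<close>: every slot may collide. It suffices where
  \<open>C\<close> itself is polylogarithmic in \<open>n\<close>.\<close>

lemma expected_collision_cost_le_latency:
  assumes "C \<ge> 0" "latency n \<omega> \<le> enat T"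
  shows "expected_collision_cost d C \<epsilon> n \<omega> \<le> ennreal (C * real T)"
proof -
  obtain t where t: "latency n \<omega> = enat (Suc t)" "Suc t \<le> T"
    using assms(2) by (cases n \<omega> rule: latency_cases) auto
  have "expected_collision_cost d C \<epsilon> n \<omega> \<le> ennreal (C * (\<Sum>s<t. 1))"
    using assms(1)
    by (intro expected_collision_cost_le t(1))
       (auto intro!: measure_pmf.finite_measure_mono dest: collision_imp_not_success)
  also have "\<dots> \<le> ennreal (C * real T)"
    using assms(1) t(2) by (intro ennreal_leI mult_left_mono) auto
  finally show ?thesis .
qed

text \<open>All events of the theorem contain an event of the form
  \<open>latency n \<omega> \<le> enat T\<close>, so one probability estimate serves them
  all.\<close>

lemma AH_prob_mono:
  assumes "measure (AH d C \<epsilon> n) {\<omega>. latency n \<omega> \<le> enat T} \<ge> p"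
    and "{\<omega> \<in> space (AH d C \<epsilon> n). P \<omega>} \<in> sets (AH d C \<epsilon> n)"
    and "\<And>\<omega>. latency n \<omega> \<le> enat T \<Longrightarrow> P \<omega>"
  shows "\<P>(\<omega> in AH d C \<epsilon> n. P \<omega>) \<ge> p"
proof -
  interpret prob_space "AH d C \<epsilon> n" unfolding AH_eq_slots by (rule prob_space_slots)
  have "prob {\<omega>. latency n \<omega> \<le> enat T} \<le> \<P>(\<omega> in AH d C \<epsilon> n. P \<omega>)"
    using assms(2,3) by (intro finite_measure_mono) (auto simp: AH_eq_slots)
  with assms(1) show ?thesis by linarith
qed

lemma AH_bounds:
  assumes T: "measure (AH d C \<epsilon> n) {\<omega>. latency n \<omega> \<le> enat T} \<ge> p" "real T \<le> v"
    and cost: "\<And>\<omega>. latency n \<omega> \<le> enat T \<Longrightarrow> expected_collision_cost d C \<epsilon> n \<omega> \<le> ennreal v"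
  shows "\<P>(\<omega> in AH d C \<epsilon> n. solved n \<omega>) \<ge> p"
    and "\<P>(\<omega> in AH d C \<epsilon> n. ennreal_of_enat (latency n \<omega>) \<le> ennreal v) \<ge> p"
    and "\<P>(\<omega> in AH d C \<epsilon> n. expected_collision_cost d C \<epsilon> n \<omega> \<le> ennreal v) \<ge> p"
proof -
  show "\<P>(\<omega> in AH d C \<epsilon> n. solved n \<omega>) \<ge> p"
    by (rule AH_prob_mono[OF T(1)])
       (unfold AH_eq_slots solved_def, measurable, auto simp: latency_le_iff)
  show "\<P>(\<omega> in AH d C \<epsilon> n. ennreal_of_enat (latency n \<omega>) \<le> ennreal v) \<ge> p"
  proof (rule AH_prob_mono[OF T(1)])
    fix \<omega> assume "latency n \<omega> \<le> enat T"
    then have "ennreal_of_enat (latency n \<omega>) \<le> ennreal_of_enat (enat T)"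
      by (simp only: ennreal_of_enat_le_iff)
    also have "\<dots> = ennreal (real T)" by (simp add: ennreal_of_nat_eq_real_of_nat)
    also have "\<dots> \<le> ennreal v" using T(2) by (rule ennreal_leI)
    finally show "ennreal_of_enat (latency n \<omega>) \<le> ennreal v" .
  qed (unfold AH_eq_slots, measurable)
  show "\<P>(\<omega> in AH d C \<epsilon> n. expected_collision_cost d C \<epsilon> n \<omega> \<le> ennreal v) \<ge> p"
    by (rule AH_prob_mono[OF T(1) _ cost]) (unfold AH_eq_slots, measurable)
qed

section \<open>Comparison of \<open>C\<close> with powers of \<open>ln n\<close>\<close>

lemma initial_window_ge:
  assumes \<epsilon>: "\<epsilon> > 0" and n: "n \<ge> 4" and C: "4 \<le> C" "C \<le> A * real n powr B" and A: "A > 0"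
    and c: "c > 0" "C \<ge> c * ln (real n) powr (1 + 2 / \<epsilon>)"
    and large: "ln (real n) + (ln A + B * ln (real n)) / 2 \<le> c powr \<epsilon> * ln 2 * (ln (real n))\<^sup>2"
    and ln_ge: "1 \<le> ln (real n)"
  shows "real n * sqrt C \<le> 2 powr (C powr \<epsilon>)"
proof -
  let ?L = "ln (real n)"
  \<comment> \<open>The comparison is made between logarithms: as \<open>C\<close> is polynomial in
    \<open>n\<close>, that of \<open>n * sqrt C\<close> is only linear in
    \<open>ln n\<close>.\<close>
  have "ln C \<le> ln (A * real n powr B)" using C by (intro ln_mono) auto
  also have "\<dots> = ln A + B * ?L" using A n by (simp add: ln_mult ln_powr)
  finally have "ln (real n * sqrt C) \<le> ?L + (ln A + B * ?L) / 2"
    using n C by (simp add: ln_mult ln_sqrt)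
  also note large
  \<comment> \<open>The exponent \<open>1 + 2 / \<epsilon>\<close> is chosen for this step:
    multiplied by \<epsilon> it is at least 2, so the logarithm of the initial window is at least
    quadratic in \<open>ln n\<close>.\<close>
  also have "c powr \<epsilon> * ln 2 * ?L\<^sup>2 \<le> c powr \<epsilon> * ln 2 * ?L powr ((1 + 2 / \<epsilon>) * \<epsilon>)"
  proof (intro mult_left_mono)
    have "?L\<^sup>2 = ?L powr 2" using ln_ge by simp
    also have "\<dots> \<le> ?L powr ((1 + 2 / \<epsilon>) * \<epsilon>)"
      using ln_ge \<epsilon> by (intro powr_mono) (auto simp: field_simps)
    finally show "?L\<^sup>2 \<le> ?L powr ((1 + 2 / \<epsilon>) * \<epsilon>)" .
  qed auto
  also have "\<dots> = (c * ?L powr (1 + 2 / \<epsilon>)) powr \<epsilon> * ln 2"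
    using c ln_ge by (simp add: powr_mult powr_powr)
  also have "\<dots> \<le> C powr \<epsilon> * ln 2"
    using c \<epsilon> by (intro mult_right_mono powr_mono2) auto
  also have "\<dots> = ln (2 powr (C powr \<epsilon>))" by (simp add: ln_powr)
  finally show ?thesis
    using n C by (subst (asm) ln_le_cancel_iff) auto
qed

text \<open>The product \<open>(1 + 2 / \<epsilon>) * (1 / 2 + 2 * \<epsilon>)\<close> is at most
  \<open>7 + 1 / \<epsilon>\<close> because \<epsilon> is below 1. Multiplying by \<open>C\<close>
  adds \<open>1 + 2 / \<epsilon>\<close>, which gives the exponent
  \<open>8 + 3 / \<epsilon>\<close>.\<close>

lemma polylog_bounds:
  fixes L :: real
  assumes \<epsilon>: "0 < \<epsilon>" "\<epsilon> < 1" and d: "d > 0" and C: "0 < C" "C < c * L powr (1 + 2 / \<epsilon>)"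
    and c: "c > 0" and L: "1 \<le> L"
    and T: "T \<le> (d + 1) * C powr (1 / 2 + 2 * \<epsilon>) + 9 * (d + 1) * L\<^sup>2" "0 \<le> T"
  defines "K \<equiv> (d + 1) * c powr (1 / 2 + 2 * \<epsilon>) + 9 * (d + 1)"
  shows "T \<le> K * L powr (8 + 3 / \<epsilon>)" "C * T \<le> c * K * L powr (8 + 3 / \<epsilon>)"
proof -
  have "C powr (1 / 2 + 2 * \<epsilon>) \<le> (c * L powr (1 + 2 / \<epsilon>)) powr (1 / 2 + 2 * \<epsilon>)"
    using C \<epsilon> by (intro powr_mono2) auto
  also have "\<dots> = c powr (1 / 2 + 2 * \<epsilon>) * L powr ((1 + 2 / \<epsilon>) * (1 / 2 + 2 * \<epsilon>))"
    using c L by (simp add: powr_mult powr_powr)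
  also have "\<dots> \<le> c powr (1 / 2 + 2 * \<epsilon>) * L powr (7 + 1 / \<epsilon>)"
  proof (intro mult_left_mono powr_mono)
    have "(1 + 2 / \<epsilon>) * (1 / 2 + 2 * \<epsilon>) = 9 / 2 + 2 * \<epsilon> + 1 / \<epsilon>"
      using \<epsilon> by (simp add: field_simps)
    then show "(1 + 2 / \<epsilon>) * (1 / 2 + 2 * \<epsilon>) \<le> 7 + 1 / \<epsilon>" using \<epsilon> by simp
  qed (use L in auto)
  finally have 1: "C powr (1 / 2 + 2 * \<epsilon>) \<le> c powr (1 / 2 + 2 * \<epsilon>) * L powr (7 + 1 / \<epsilon>)" .
  have "L\<^sup>2 = L powr 2" using L by simp
  also have "\<dots> \<le> L powr (7 + 1 / \<epsilon>)" using L \<epsilon> by (intro powr_mono) (auto intro: add_increasing2)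
  finally have 2: "L\<^sup>2 \<le> L powr (7 + 1 / \<epsilon>)" .
  have "T \<le> (d + 1) * (c powr (1 / 2 + 2 * \<epsilon>) * L powr (7 + 1 / \<epsilon>)) +
      9 * (d + 1) * L powr (7 + 1 / \<epsilon>)"
    using d by (intro order.trans[OF T(1)] add_mono mult_left_mono 1 2) auto
  then have 3: "T \<le> K * L powr (7 + 1 / \<epsilon>)" by (simp add: K_def algebra_simps)
  have K: "0 \<le> K" unfolding K_def using d by simp
  note 3
  also have "K * L powr (7 + 1 / \<epsilon>) \<le> K * L powr (8 + 3 / \<epsilon>)"
    using K L \<epsilon> by (intro mult_left_mono powr_mono add_mono divide_right_mono) auto
  finally show "T \<le> K * L powr (8 + 3 / \<epsilon>)" .
  have "C * T \<le> (c * L powr (1 + 2 / \<epsilon>)) * (K * L powr (7 + 1 / \<epsilon>))"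
    using C 3 T(2) c by (intro mult_mono) auto
  also have "\<dots> = c * K * (L powr ((1 + 2 / \<epsilon>) + (7 + 1 / \<epsilon>)))"
    by (subst powr_add) (simp add: algebra_simps)
  also have "(1 + 2 / \<epsilon>) + (7 + 1 / \<epsilon>) = 8 + 3 / \<epsilon>" using \<epsilon> by (simp add: field_simps)
  finally show "C * T \<le> c * K * L powr (8 + 3 / \<epsilon>)" .
qed

text \<open>The third condition ensures \<open>C \<le> n\<close> in the second regime; the last one
  is the hypothesis \<open>large\<close> of \<open>initial_window_ge\<close>.\<close>

lemma eventually_large_n:
  fixes A B c \<epsilon> q :: real
  assumes "c > 0" "q > 0"
  shows "\<forall>\<^sub>F n in sequentially. n \<ge> 4 \<and> 1 \<le> ln (real n) \<and> c * ln (real n) powr q \<le> real n \<and>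
    ln (real n) + (ln A + B * ln (real n)) / 2 \<le> c powr \<epsilon> * ln 2 * (ln (real n))\<^sup>2"
proof -
  define e where "e = c powr \<epsilon> * ln 2"
  have "e > 0" unfolding e_def using assms by simp
  then have "\<forall>\<^sub>F n in sequentially.
      ln (real n) + (ln A + B * ln (real n)) / 2 \<le> e * (ln (real n))\<^sup>2"
    by real_asymp
  moreover have "\<forall>\<^sub>F n in sequentially. c * ln (real n) powr q \<le> real n"
    using assms by real_asymp
  moreover have "\<forall>\<^sub>F n in sequentially. 1 \<le> ln (real n)"
    by real_asymp
  ultimately show ?thesis
    unfolding e_def using eventually_ge_at_top[of 4] by eventually_elim auto
qed

section \<open>Choice of the constants and the final case distinction\<close>

theorem theorem1:
  shows "\<exists>k k' m m' :: real. k \<ge> 1 \<and> k' \<ge> 1 \<and> m \<ge> 1 \<and> m' \<ge> 1 \<and>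
    (\<forall>\<epsilon> :: real. 0 < \<epsilon> \<and> \<epsilon> < 1 \<longrightarrow>
    (\<forall>a :: real. a > 0 \<longrightarrow>
    (\<exists>d\<^sub>0 :: real. d\<^sub>0 > 0 \<and>
    (\<forall>d \<ge> d\<^sub>0. \<forall>A B c :: real. A > 0 \<and> B > 0 \<and> c > 0 \<longrightarrow>
    (\<exists>(K :: real) n\<^sub>0. K > 0 \<and>
    (\<forall>n \<ge> n\<^sub>0. \<forall>C :: real. 4 \<le> C \<and> C \<le> A * real n powr B \<longrightarrow>
      (let \<eta> = max (real n) C;
           p = 1 - K / \<eta> powr a;
           v\<^sub>1 = K * C powr (1 / 2 + 2 * \<epsilon>);
           v\<^sub>2 = K * ln (real n) powr (m + m' / \<epsilon>)
       in
         \<P>(\<omega> in AH d C \<epsilon> n. solved n \<omega>) \<ge> p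
       \<and> (C \<ge> c * ln (real n) powr (k + k' / \<epsilon>) \<longrightarrow>
            \<P>(\<omega> in AH d C \<epsilon> n. ennreal_of_enat (latency n \<omega>) \<le> ennreal v\<^sub>1) \<ge> p
          \<and> \<P>(\<omega> in AH d C \<epsilon> n. expected_collision_cost d C \<epsilon> n \<omega> \<le> ennreal v\<^sub>1) \<ge> p)
       \<and> (\<not> C \<ge> c * ln (real n) powr (k + k' / \<epsilon>) \<longrightarrow>
            \<P>(\<omega> in AH d C \<epsilon> n. ennreal_of_enat (latency n \<omega>) \<le> ennreal v\<^sub>2) \<ge> p
          \<and> \<P>(\<omega> in AH d C \<epsilon> n. expected_collision_cost d C \<epsilon> n \<omega> \<le> ennreal v\<^sub>2) \<ge> p
          \<and> \<P>(\<omega> in AH d C \<epsilon> n. collision_cost C n \<omega> \<le> ennreal v\<^sub>2) \<ge> p))))))))"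
proof -
  have main: "\<exists>(K :: real) n\<^sub>0. K > 0 \<and>
    (\<forall>n \<ge> n\<^sub>0. \<forall>C :: real. 4 \<le> C \<and> C \<le> A * real n powr B \<longrightarrow>
      (let \<eta> = max (real n) C;
           p = 1 - K / \<eta> powr a;
           v\<^sub>1 = K * C powr (1 / 2 + 2 * \<epsilon>);
           v\<^sub>2 = K * ln (real n) powr (8 + 3 / \<epsilon>)
       in
         \<P>(\<omega> in AH d C \<epsilon> n. solved n \<omega>) \<ge> p
       \<and> (C \<ge> c * ln (real n) powr (1 + 2 / \<epsilon>) \<longrightarrow>
            \<P>(\<omega> in AH d C \<epsilon> n. ennreal_of_enat (latency n \<omega>) \<le> ennreal v\<^sub>1) \<ge> p
          \<and> \<P>(\<omega> in AH d C \<epsilon> n. expected_collision_cost d C \<epsilon> n \<omega> \<le> ennreal v\<^sub>1) \<ge> p)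
       \<and> (\<not> C \<ge> c * ln (real n) powr (1 + 2 / \<epsilon>) \<longrightarrow>
            \<P>(\<omega> in AH d C \<epsilon> n. ennreal_of_enat (latency n \<omega>) \<le> ennreal v\<^sub>2) \<ge> p
          \<and> \<P>(\<omega> in AH d C \<epsilon> n. expected_collision_cost d C \<epsilon> n \<omega> \<le> ennreal v\<^sub>2) \<ge> p
          \<and> \<P>(\<omega> in AH d C \<epsilon> n. collision_cost C n \<omega> \<le> ennreal v\<^sub>2) \<ge> p)))"
    (is "\<exists>K n\<^sub>0. K > 0 \<and> (\<forall>n\<ge>n\<^sub>0. \<forall>C. _ \<longrightarrow> ?Q K n C)")
    if \<epsilon>: "0 < \<epsilon>" "\<epsilon> < 1" and a: "a > 0" and d: "d \<ge> 8 * a"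
      and ABc: "A > 0" "B > 0" "c > 0" for \<epsilon> a d A B c :: real
  proof -
    have d0: "d > 0" using a d by linarith
    obtain n\<^sub>0 where n\<^sub>0: "\<And>n. n \<ge> n\<^sub>0 \<Longrightarrow> n \<ge> 4 \<and> 1 \<le> ln (real n) \<and>
        c * ln (real n) powr (1 + 2 / \<epsilon>) \<le> real n \<and>
        ln (real n) + (ln A + B * ln (real n)) / 2 \<le> c powr \<epsilon> * ln 2 * (ln (real n))\<^sup>2"
      using eventually_large_n[of c "1 + 2 / \<epsilon>" A B \<epsilon>] ABc \<epsilon>
      unfolding eventually_sequentially by (metis add_pos_pos zero_less_divide_iff zero_less_one zero_less_numeral)
    define K' where "K' = (d + 1) * c powr (1 / 2 + 2 * \<epsilon>) + 9 * (d + 1)"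
    have K': "0 \<le> K'" unfolding K'_def using d0 by simp
    \<comment> \<open>The summands dominate the constants of the expected cost in the first regime
      and of the latency and the cost in the second; \<open>K\<close> is also at least 1, as the
      failure probability requires.\<close>
    define K where "K = 4 * (d + 1) + K' + c * K'"
    have K: "1 \<le> K" "d + 1 \<le> K" "4 * (d + 1) \<le> K" "K' \<le> K" "c * K' \<le> K"
      unfolding K_def using K' d0 ABc by (auto intro: add_increasing add_increasing2)
    have "?Q K n C" if n: "n \<ge> n\<^sub>0" and C: "4 \<le> C" "C \<le> A * real n powr B" for n C
    proof -
      let ?L = "ln (real n)"
      let ?p = "1 - K / max (real n) C powr a"
      note big = n\<^sub>0[OF n]
      have p: "?p \<le> 1 - 1 / max (real n) C powr a"
        using K(1) by (simp add: divide_right_mono)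
      show ?thesis
      proof (cases "C \<ge> c * ?L powr (1 + 2 / \<epsilon>)")
        case True
        have W: "real n * sqrt C \<le> 2 powr (C powr \<epsilon>)"
          using big True C \<epsilon> ABc by (intro initial_window_ge[of \<epsilon> n C A B c]) auto
        have n1: "n \<ge> 1" using big by linarith
        obtain T where T: "real T \<le> (d + 1) * C powr (1 / 2 + 2 * \<epsilon>)"
          "measure (AH d C \<epsilon> n) {\<omega>. latency n \<omega> \<le> enat T} \<ge> 1 - 1 / max (real n) C powr a"
          "\<And>\<omega>. latency n \<omega> \<le> enat T \<Longrightarrow>
            expected_collision_cost d C \<epsilon> n \<omega> \<le> ennreal (4 * (d + 1) * C powr (1 / 2 + 2 * \<epsilon>))"
          using halving_regime[OF a d \<epsilon>(1) n1 C(1) W] by blast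
        have v: "real T \<le> K * C powr (1 / 2 + 2 * \<epsilon>)"
          using K by (intro order.trans[OF T(1)] mult_right_mono) auto
        have cost: "expected_collision_cost d C \<epsilon> n \<omega> \<le> ennreal (K * C powr (1 / 2 + 2 * \<epsilon>))"
          if "latency n \<omega> \<le> enat T" for \<omega>
          using K by (intro order.trans[OF T(3)[OF that]] ennreal_leI mult_right_mono) auto
        show ?thesis
          using AH_bounds[OF order.trans[OF p T(2)] v cost] True by (simp add: Let_def)
      next
        case False
        \<comment> \<open>In this regime \<open>C\<close> is below a polylogarithm of
          \<open>n\<close> and hence below \<open>n\<close>, so the failure bound in
          \<open>n\<close> is already one in \<eta>.\<close>
        have \<eta>: "max (real n) C = real n" using False big by linarith
        have n4: "n \<ge> 4" using big by blast
        obtain T where T: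
          "real T \<le> (d + 1) * C powr (1 / 2 + 2 * \<epsilon>) + 9 * (d + 1) * ?L\<^sup>2"
          "measure (AH d C \<epsilon> n) {\<omega>. latency n \<omega> \<le> enat T} \<ge> 1 - 1 / real n powr a"
          using doubling_regime[OF a d \<epsilon>(1) n4 C(1)] by blast
        have "real T \<le> K' * ?L powr (8 + 3 / \<epsilon>)" "C * real T \<le> c * K' * ?L powr (8 + 3 / \<epsilon>)"
          unfolding K'_def using False C big ABc \<epsilon> d0 T(1) by (intro polylog_bounds; simp)+
        moreover have "K' * ?L powr (8 + 3 / \<epsilon>) \<le> K * ?L powr (8 + 3 / \<epsilon>)"
          "c * K' * ?L powr (8 + 3 / \<epsilon>) \<le> K * ?L powr (8 + 3 / \<epsilon>)"
          using K by (intro mult_right_mono; simp)+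
        ultimately have v: "real T \<le> K * ?L powr (8 + 3 / \<epsilon>)"
          and Cv: "C * real T \<le> K * ?L powr (8 + 3 / \<epsilon>)"
          by linarith+
        have T2: "?p \<le> measure (AH d C \<epsilon> n) {\<omega>. latency n \<omega> \<le> enat T}"
          using p T(2) unfolding \<eta> by linarith
        have C0: "C \<ge> 0" using C by linarith
        \<comment> \<open>\<open>C\<close> times the number of slots is within the bound, so here
          even the collision cost itself is bounded on the latency event.\<close>
        have cost: "expected_collision_cost d C \<epsilon> n \<omega> \<le> ennreal (K * ?L powr (8 + 3 / \<epsilon>))"
          "collision_cost C n \<omega> \<le> ennreal (K * ?L powr (8 + 3 / \<epsilon>))"
          if "latency n \<omega> \<le> enat T" for \<omega>
          using expected_collision_cost_le_latency[OF C0 that] collision_cost_le[OF C0 that]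
            ennreal_leI[OF Cv] by (blast intro: order.trans)+
        have "\<P>(\<omega> in AH d C \<epsilon> n. collision_cost C n \<omega> \<le> ennreal (K * ?L powr (8 + 3 / \<epsilon>))) \<ge> ?p"
          by (rule AH_prob_mono[OF T2 _ cost(2)]) (unfold AH_eq_slots, measurable)
        then show ?thesis
          using AH_bounds[OF T2 v cost(1)] False by (simp add: Let_def)
      qed
    qed
    then show ?thesis using K(1) by (intro exI[of _ K] exI[of _ n\<^sub>0]) auto
  qed
  show ?thesis
    \<comment> \<open>The threshold exponent is \<open>1 + 2 / \<epsilon>\<close> from
      \<open>initial_window_ge\<close>, the bound exponent \<open>8 + 3 / \<epsilon>\<close> from
      \<open>polylog_bounds\<close>.\<close>
    apply (rule exI[of _ 1], rule exI[of _ 2], rule exI[of _ 8], rule exI[of _ 3])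
    apply (intro conjI allI impI; (simp; fail)?)
    subgoal for \<epsilon> a
      apply (rule exI[of _ "8 * a"], intro conjI allI impI)
      subgoal by simp
      subgoal for d A B c by (rule main) auto
      done
    done
qed

end
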